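(* Let $\mathcal{E}$ be the ellipse parametrized by $P(t)=(a\cos t,b\sin t)$, $a,b>0$, let $M=(x_0,y_0)$ be a point of the plane and $\theta\in\mathbb{R}$. The signed area $A_\theta$ of the rotated pedal curve $\mathcal{E}_\theta$ of $\mathcal{E}$ with respect to $M$ is $$A_\theta=\frac{\pi}{2}\left(a^2+b^2-2ab\sin^2\theta+x_0^2+y_0^2\right).$$
   Context: The rotated pedal curve $\mathcal{E}_\theta$ with respect to $M$ is the closed curve $t\mapsto Q_\theta(t)$, $t\in[0,2\pi]$, where $Q_\theta(t)$ is the foot of the perpendicular dropped from $M$ onto the line through $P(t)$ whose direction is the tangent vector $P'(t)$ rotated by the angle $\theta$ (counterclockwise). The signed area of a closed parametrized curve $\gamma$ is $\frac12\int_\gamma(x\,dy-y\,dx)$, with orientation given by increasing $t$. *)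

theory Defs
  imports "HOL-Analysis.Analysis"
begin

(* Counterclockwise for \<theta> > 0. *)
definition rotate_by :: "real \<Rightarrow> real \<times> real \<Rightarrow> real \<times> real" where
  "rotate_by \<theta> v = (cos \<theta> * fst v - sin \<theta> * snd v, sin \<theta> * fst v + cos \<theta> * snd v)"

definition line_through :: "'a::real_vector \<Rightarrow> 'a \<Rightarrow> 'a set" where
  "line_through p d = {p + s *\<^sub>R d | s. True}"

(* Meaningful for d \<noteq> 0; see foot_of_perpendicular_unique. *)
definition foot_of_perpendicular :: "'a::real_inner \<Rightarrow> 'a \<Rightarrow> 'a \<Rightarrow> 'a" where
  "foot_of_perpendicular M p d = (THE q. q \<in> line_through p d \<and> (M - q) \<bullet> d = 0)"

definition rotated_pedal ::
  "(real \<Rightarrow> real \<times> real) \<Rightarrow> real \<times> real \<Rightarrow> real \<Rightarrow> real \<Rightarrow> real \<times> real" where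
  "rotated_pedal \<gamma> M \<theta> t =
     foot_of_perpendicular M (\<gamma> t) (rotate_by \<theta> (vector_derivative \<gamma> (at t)))"

(* 1/2 of the line integral of x dy - y dx along \<gamma>, in the direction of increasing t.
   One-sided derivatives are used at the endpoints. *)
definition signed_area :: "(real \<Rightarrow> real \<times> real) \<Rightarrow> real \<Rightarrow> real \<Rightarrow> real" where
  "signed_area \<gamma> \<alpha> \<beta> = 1 / 2 * integral {\<alpha>..\<beta>} (\<lambda>t.
     let v = vector_derivative \<gamma> (at t within {\<alpha>..\<beta>})
     in fst (\<gamma> t) * snd v - snd (\<gamma> t) * fst v)"

definition ellipse :: "real \<Rightarrow> real \<Rightarrow> real \<Rightarrow> real \<times> real" where
  "ellipse a b t = (a * cos t, b * sin t)"

lemma foot_of_perpendicular_unique: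
  assumes "d \<noteq> 0"
  shows "\<exists>!q. q \<in> line_through p d \<and> (M - q) \<bullet> d = 0"
    and "foot_of_perpendicular M p d = p + (((M - p) \<bullet> d) / (d \<bullet> d)) *\<^sub>R d"
proof -
  let ?q = "p + (((M - p) \<bullet> d) / (d \<bullet> d)) *\<^sub>R d"
  have dd: "d \<bullet> d \<noteq> 0" using assms by simp
  have ex: "?q \<in> line_through p d \<and> (M - ?q) \<bullet> d = 0"
    using dd by (auto simp: line_through_def inner_diff_left inner_add_left)
  have un: "q = ?q" if q: "q \<in> line_through p d \<and> (M - q) \<bullet> d = 0" for q
  proof -
    obtain s where s: "q = p + s *\<^sub>R d" using q by (auto simp: line_through_def)
    with q have "(M - p) \<bullet> d = s * (d \<bullet> d)"
      by (simp add: inner_diff_left inner_add_left)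
    then show ?thesis using s dd by simp
  qed
  show "\<exists>!q. q \<in> line_through p d \<and> (M - q) \<bullet> d = 0" using ex un by blast
  show "foot_of_perpendicular M p d = ?q"
    unfolding foot_of_perpendicular_def using ex un by (rule the_equality)
qed

lemma vector_derivative_ellipse:
  "vector_derivative (ellipse a b) (at t) = (- a * sin t, b * cos t)"
  unfolding ellipse_def
  by (rule vector_derivative_at)
     (auto intro!: has_vector_derivative_Pair derivative_eq_intros
           simp: has_real_derivative_iff_has_vector_derivative[symmetric])

lemma rotate_tangent_ellipse_nonzero:
  assumes "a > 0" "b > 0"
  shows "rotate_by \<theta> (vector_derivative (ellipse a b) (at t)) \<noteq> 0"
proof
  assume z: "rotate_by \<theta> (vector_derivative (ellipse a b) (at t)) = 0"
  define u v where "u = - a * sin t" and "v = b * cos t"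
  have e: "cos \<theta> * u - sin \<theta> * v = 0" "sin \<theta> * u + cos \<theta> * v = 0"
    using z by (auto simp: rotate_by_def vector_derivative_ellipse u_def v_def prod_eq_iff)
  have "u\<^sup>2 + v\<^sup>2 = (cos \<theta> * u - sin \<theta> * v)\<^sup>2 + (sin \<theta> * u + cos \<theta> * v)\<^sup>2
          + (1 - ((sin \<theta>)\<^sup>2 + (cos \<theta>)\<^sup>2)) * (u\<^sup>2 + v\<^sup>2)" by algebra
  then have "u = 0" "v = 0" using e by (auto simp: sum_power2_eq_zero_iff)
  then have "sin t = 0" "cos t = 0" using assms by (auto simp: u_def v_def)
  then show False using sin_cos_squared_add[of t] by simp
qed

(* The pedal curve is closed and continuously differentiable, so the integral in signed_area
   is a genuine one. *)
lemma rotated_pedal_ellipse_closed: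
  "rotated_pedal (ellipse a b) M \<theta> (2 * pi) = rotated_pedal (ellipse a b) M \<theta> 0"
  by (simp add: rotated_pedal_def vector_derivative_ellipse) (simp add: ellipse_def)

lemma rotated_pedal_ellipse_C1:
  assumes "a > 0" "b > 0"
  shows "rotated_pedal (ellipse a b) M \<theta> C1_differentiable_on S"
proof -
  let ?u = "\<lambda>t. cos \<theta> * (- a * sin t) - sin \<theta> * (b * cos t)"
  let ?v = "\<lambda>t. sin \<theta> * (- a * sin t) + cos \<theta> * (b * cos t)"
  let ?N = "\<lambda>t. (fst M - a * cos t) * ?u t + (snd M - b * sin t) * ?v t"
  let ?u' = "\<lambda>t. cos \<theta> * (- a * cos t) + sin \<theta> * (b * sin t)"
  let ?v' = "\<lambda>t. sin \<theta> * (- a * cos t) - cos \<theta> * (b * sin t)"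
  let ?N' = "\<lambda>t. (fst M - a * cos t) * ?u' t + a * sin t * ?u t
                  + (snd M - b * sin t) * ?v' t - b * cos t * ?v t"
  let ?D = "\<lambda>t. ?u t * ?u t + ?v t * ?v t"
  let ?s' = "\<lambda>t. (?N' t * ?D t - ?N t * (2 * ?u t * ?u' t + 2 * ?v t * ?v' t)) / (?D t * ?D t)"
  have nz: "(?u t, ?v t) \<noteq> 0" for t
    using rotate_tangent_ellipse_nonzero[OF assms, of \<theta> t]
    by (simp add: vector_derivative_ellipse rotate_by_def)
  then have D: "?D t \<noteq> 0" for t
    by (auto simp: prod_eq_iff sum_squares_eq_zero_iff simp del: mult_minus_left mult_minus_right)
  have eq: "rotated_pedal (ellipse a b) M \<theta> =
      (\<lambda>t. (a * cos t + ?N t / ?D t * ?u t, b * sin t + ?N t / ?D t * ?v t))"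
  proof
    fix t
    show "rotated_pedal (ellipse a b) M \<theta> t =
        (a * cos t + ?N t / ?D t * ?u t, b * sin t + ?N t / ?D t * ?v t)"
      using foot_of_perpendicular_unique(2)[OF nz[of t], of M "ellipse a b t"]
      by (cases M) (simp add: rotated_pedal_def vector_derivative_ellipse rotate_by_def ellipse_def)
  qed
  have u: "(?u has_real_derivative ?u' t) (at t)" for t
    by (auto intro!: derivative_eq_intros)
  have v: "(?v has_real_derivative ?v' t) (at t)" for t
    by (auto intro!: derivative_eq_intros)
  have N: "(?N has_real_derivative ?N' t) (at t)" for t
    by (rule derivative_eq_intros u v refl)+ (simp add: algebra_simps)
  have DD: "(?D has_real_derivative (2 * ?u t * ?u' t + 2 * ?v t * ?v' t)) (at t)" for t
    by (rule derivative_eq_intros u v refl)+ (simp only: algebra_simps mult_2)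
  have s: "((\<lambda>t. ?N t / ?D t) has_real_derivative ?s' t) (at t)" for t
    by (rule DERIV_divide[OF N DD D])
  have x: "((\<lambda>t. a * cos t + ?N t / ?D t * ?u t) has_real_derivative
      (- a * sin t + (?s' t * ?u t + ?u' t * (?N t / ?D t)))) (at t)" for t
    by (intro DERIV_add DERIV_mult s u) (auto intro!: derivative_eq_intros)
  have y: "((\<lambda>t. b * sin t + ?N t / ?D t * ?v t) has_real_derivative
      (b * cos t + (?s' t * ?v t + ?v' t * (?N t / ?D t)))) (at t)" for t
    by (intro DERIV_add DERIV_mult s v) (auto intro!: derivative_eq_intros)
  have DD0: "?D t * ?D t \<noteq> 0" for t using D by (simp only: mult_eq_0_iff) simp
  show ?thesis
    unfolding C1_differentiable_on_def eq
  proof (intro exI conjI ballI)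
    fix t
    show "((\<lambda>t. (a * cos t + ?N t / ?D t * ?u t, b * sin t + ?N t / ?D t * ?v t))
        has_vector_derivative
          ((- a * sin t + (?s' t * ?u t + ?u' t * (?N t / ?D t))),
           (b * cos t + (?s' t * ?v t + ?v' t * (?N t / ?D t))))) (at t)"
      using x y by (intro has_vector_derivative_Pair)
        (simp_all only: has_real_derivative_iff_has_vector_derivative)
  next
    show "continuous_on S (\<lambda>t.
          ((- a * sin t + (?s' t * ?u t + ?u' t * (?N t / ?D t))),
           (b * cos t + (?s' t * ?v t + ?v' t * (?N t / ?D t)))))"
      by (intro continuous_intros ballI D DD0)
  qed
qed

end

theory Submission
  imports Defs
begin

text \<open>
  Let \<open>w(t)\<close> be the outward normal \<open>(b cos t, a sin t)\<close> of the ellipse, rotated by \<open>\<theta>\<close>.  It is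
  orthogonal to the rotated tangent, so the foot of the perpendicular is \<open>M + (N / D) w\<close> with
  \<open>N = (P - M) \<bullet> w\<close> and \<open>D = \<bar>w\<bar>\<^sup>2\<close>
  (\<open>foot_of_perpendicular_normal\<close>).  For a closed curve of the form \<open>M + f w\<close> only the area swept
  out around \<open>M\<close> matters, and the derivative of \<open>f\<close> drops out of it
  (\<open>signed_area_translated\<close>).  Since \<open>w\<^sub>1 w\<^sub>2' - w\<^sub>2 w\<^sub>1' = a b\<close>, twice the area is the
  integral of \<open>N\<^sup>2 a b / D\<^sup>2\<close>; writing \<open>\<phi>\<close> for the polar angle of the unrotated normal,
  \<open>d\<phi> = (a b / D) dt\<close> and this is the integral of \<open>(N\<^sup>2 / D) d\<phi>\<close>.

  Now \<open>N = A - B\<close> with \<open>A = P \<bullet> w\<close> and \<open>B = M \<bullet> w\<close>.  Replacing \<open>t\<close> by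
  \<open>t + \<pi>\<close> turns \<open>P\<close> and \<open>w\<close> into their negatives, so \<open>A B\<close> changes sign and contributes nothing
  (\<open>has_integral_antiperiodic\<close>).  The rest, \<open>A\<^sup>2 + B\<^sup>2\<close>, is a quadratic form in
  \<open>(b cos t, a sin t)\<close> minus \<open>sin\<^sup>2 \<theta> D\<^sup>2\<close>.  The quadratic form divided by \<open>D\<close> is one in
  \<open>(cos \<phi>, sin \<phi>)\<close>, whose integral over a full turn is \<open>\<pi>\<close> times its trace,
  \<open>\<pi> (a\<^sup>2 + b\<^sup>2 + x\<^sub>0\<^sup>2 + y\<^sub>0\<^sup>2)\<close> (\<open>has_integral_quadratic_form\<close>); the other term contributes
  \<open>- 2 \<pi> a b sin\<^sup>2 \<theta>\<close>.
\<close>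

text \<open>
  Two cancellations make this work.  The part of the integrand containing the fixed point
  \<open>(x\<^sub>0, y\<^sub>0)\<close> as a factor is an exact derivative and integrates to zero over a closed curve.  In the part
  that remains, the derivative of \<open>f\<close> multiplies the cross product of \<open>(u, v)\<close> with itself.
\<close>

lemma signed_area_translated:
  fixes f u v :: "real \<Rightarrow> real"
  assumes "\<alpha> < \<beta>"
    and \<gamma>: "\<And>t. \<gamma> t = (x\<^sub>0 + f t * u t, y\<^sub>0 + f t * v t)"
    and closed: "\<gamma> \<beta> = \<gamma> \<alpha>"
    and f: "\<And>t. (f has_real_derivative f' t) (at t)"
    and u: "\<And>t. (u has_real_derivative u' t) (at t)"
    and v: "\<And>t. (v has_real_derivative v' t) (at t)"
    and I: "((\<lambda>t. (f t)\<^sup>2 * (u t * v' t - v t * u' t)) has_integral I) {\<alpha>..\<beta>}"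
  shows "signed_area \<gamma> \<alpha> \<beta> = I / 2"
proof -
  define x' y' where "x' t = f' t * u t + u' t * f t" and "y' t = f' t * v t + v' t * f t" for t
  have x: "((\<lambda>t. x\<^sub>0 + f t * u t) has_real_derivative x' t) (at t)" for t
    unfolding x'_def by (auto intro!: derivative_eq_intros f u)
  have y: "((\<lambda>t. y\<^sub>0 + f t * v t) has_real_derivative y' t) (at t)" for t
    unfolding y'_def by (auto intro!: derivative_eq_intros f v)
  have "(\<gamma> has_vector_derivative (x' t, y' t)) (at t)" for t
    using x y unfolding \<gamma>
    by (intro has_vector_derivative_Pair)
      (simp_all only: has_real_derivative_iff_has_vector_derivative)
  then have \<gamma>': "vector_derivative \<gamma> (at t within {\<alpha>..\<beta>}) = (x' t, y' t)"
    if "t \<in> {\<alpha>..\<beta>}" for t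
    using that \<open>\<alpha> < \<beta>\<close>
    by (metis has_vector_derivative_at_within vector_derivative_within_closed_interval)
  have "((\<lambda>t. x\<^sub>0 * y' t - y\<^sub>0 * x' t) has_integral
      (x\<^sub>0 * (y\<^sub>0 + f \<beta> * v \<beta>) - y\<^sub>0 * (x\<^sub>0 + f \<beta> * u \<beta>))
      - (x\<^sub>0 * (y\<^sub>0 + f \<alpha> * v \<alpha>) - y\<^sub>0 * (x\<^sub>0 + f \<alpha> * u \<alpha>))) {\<alpha>..\<beta>}"
    using \<open>\<alpha> < \<beta>\<close>
    by (intro fundamental_theorem_of_calculus)
      (auto simp flip: has_real_derivative_iff_has_vector_derivative
        intro!: DERIV_diff DERIV_cmult DERIV_subset[OF x] DERIV_subset[OF y])
  then have "((\<lambda>t. x\<^sub>0 * y' t - y\<^sub>0 * x' t) has_integral 0) {\<alpha>..\<beta>}"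
    using closed by (simp add: \<gamma>)
  from has_integral_add[OF this I]
  have "((\<lambda>t. x\<^sub>0 * y' t - y\<^sub>0 * x' t + (f t)\<^sup>2 * (u t * v' t - v t * u' t))
      has_integral I) {\<alpha>..\<beta>}" by simp
  then have "((\<lambda>t. let w = vector_derivative \<gamma> (at t within {\<alpha>..\<beta>})
      in fst (\<gamma> t) * snd w - snd (\<gamma> t) * fst w) has_integral I) {\<alpha>..\<beta>}"
    by (rule has_integral_eq[rotated])
      (simp add: \<gamma>' \<gamma> x'_def y'_def algebra_simps power2_eq_square)
  then show ?thesis
    unfolding signed_area_def by (simp add: integral_unique)
qed

text \<open>
  For a line with normal \<open>(u, v)\<close>, the vector from the given point to the foot is the projection
  of the vector to any point of the line onto the normal.
\<close>

lemma foot_of_perpendicular_normal: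
  fixes u v :: real
  assumes "u\<^sup>2 + v\<^sup>2 \<noteq> 0"
  shows "foot_of_perpendicular (x\<^sub>0, y\<^sub>0) (x, y) (- v, u) =
    (x\<^sub>0 + ((x - x\<^sub>0) * u + (y - y\<^sub>0) * v) / (u\<^sup>2 + v\<^sup>2) * u,
     y\<^sub>0 + ((x - x\<^sub>0) * u + (y - y\<^sub>0) * v) / (u\<^sup>2 + v\<^sup>2) * v)"
proof -
  have d: "(- v, u) \<noteq> 0" using assms by (auto simp: prod_eq_iff)
  have D: "v * v + u * u = u\<^sup>2 + v\<^sup>2" by (simp add: power2_eq_square)
  have "x + ((x\<^sub>0 - x) * (- v) + (y\<^sub>0 - y) * u) / (u\<^sup>2 + v\<^sup>2) * (- v) =
      x\<^sub>0 + ((x - x\<^sub>0) * u + (y - y\<^sub>0) * v) / (u\<^sup>2 + v\<^sup>2) * u"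
    "y + ((x\<^sub>0 - x) * (- v) + (y\<^sub>0 - y) * u) / (u\<^sup>2 + v\<^sup>2) * u =
      y\<^sub>0 + ((x - x\<^sub>0) * u + (y - y\<^sub>0) * v) / (u\<^sup>2 + v\<^sup>2) * v"
    using assms by (simp_all add: field_simps) algebra+
  then show ?thesis
    unfolding foot_of_perpendicular_unique(2)[OF d] by (simp add: D)
qed

lemma has_integral_antiperiodic:
  fixes f :: "real \<Rightarrow> real"
  assumes "continuous_on UNIV f" and "0 \<le> c" and anti: "\<And>t. f (t + c) = - f t"
  shows "(f has_integral 0) {0..2 * c}"
proof -
  define J where "J = integral {0..c} f"
  have J: "(f has_integral J) {0..c}"
    unfolding J_def
    by (intro integrable_integral integrable_continuous_real continuous_on_subset[OF assms(1)]) auto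
  have "((\<lambda>t. f (t + c)) has_integral - J) {0..c}"
    using has_integral_neg[OF J] by (simp add: anti)
  then have "(f has_integral - J) {c..2 * c}"
    using has_integral_shift_Icc_real[of f c "- J" 0 c] by (simp add: o_def add.commute)
  from has_integral_combine[OF _ _ J this] show ?thesis
    using \<open>0 \<le> c\<close> by simp
qed

lemma ellipse_speed_pos:
  fixes a b :: real
  assumes "a > 0" "b > 0"
  shows "(b * cos t)\<^sup>2 + (a * sin t)\<^sup>2 > 0"
  using assms sin_cos_squared_add[of t]
  by (metis less_irrefl mult_eq_0_iff power_zero_numeral sum_power2_gt_zero_iff zero_neq_one add_0)

text \<open>
  The function differentiated here is the polar angle of the normal vector
  \<open>(b cos t, a sin t)\<close>, which makes its derivative the usual expression for the
  angular velocity.  The arctangent of \<open>(a / b) tan t\<close> would have to be continued across its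
  poles; the tangent of the difference between the polar angle and \<open>t\<close> has none, because by the
  addition formula its denominator is \<open>b cos\<^sup>2 t + a sin\<^sup>2 t > 0\<close>.  In this form it is
  visible that the angle grows by \<open>2\<pi>\<close> along the ellipse.
\<close>

lemma ellipse_normal_angle_derivative:
  fixes a b :: real
  assumes ab: "a > 0" "b > 0"
  shows "((\<lambda>t. t + arctan ((a - b) * sin t * cos t / (b * (cos t)\<^sup>2 + a * (sin t)\<^sup>2)))
     has_real_derivative a * b / ((b * cos t)\<^sup>2 + (a * sin t)\<^sup>2)) (at t)"
proof -
  define s c where "s = sin t" and "c = cos t"
  have sc: "s\<^sup>2 + c\<^sup>2 = 1" unfolding s_def c_def by simp
  let ?n = "(a - b) * s * c" and ?d = "b * c\<^sup>2 + a * s\<^sup>2"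
  have d: "?d > 0"
  proof (cases "s = 0")
    case False
    then have "a * s\<^sup>2 > 0" using ab by simp
    then show ?thesis using ab by (simp add: add_nonneg_pos)
  qed (use ab sc in auto)
  have D: "(b * c)\<^sup>2 + (a * s)\<^sup>2 > 0" using ellipse_speed_pos[OF ab, of t] by (simp add: s_def c_def)
  \<comment> \<open>\<open>(?d, ?n)\<close> is the normal \<open>(b c, a s)\<close> rotated by \<open>- t\<close>\<close>
  have sum: "?d\<^sup>2 + ?n\<^sup>2 = (b * c)\<^sup>2 + (a * s)\<^sup>2"
    using sc by algebra
  have "1 + (((a - b) * (c * c - s * s)) * ?d - ?n * (2 * (a - b) * s * c)) / (?d\<^sup>2 + ?n\<^sup>2)
      = a * b / ((b * c)\<^sup>2 + (a * s)\<^sup>2)"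
  proof -
    have "(b * c)\<^sup>2 + (a * s)\<^sup>2 + (((a - b) * (c * c - s * s)) * ?d - ?n * (2 * (a - b) * s * c)) = a * b"
      using sc by algebra
    then show ?thesis unfolding sum using D by (simp add: field_simps)
  qed
  moreover have "inverse (1 + (?n / ?d)\<^sup>2) * (E / (?d * ?d)) = E / (?d\<^sup>2 + ?n\<^sup>2)" for E
    using d D sum by (simp add: divide_simps power2_eq_square)
  ultimately have eq: "1 + inverse (1 + (?n / ?d)\<^sup>2) *
      ((((a - b) * (c * c - s * s)) * ?d - ?n * (2 * (a - b) * s * c)) / (?d * ?d))
      = a * b / ((b * c)\<^sup>2 + (a * s)\<^sup>2)"
    by simp
  have n': "((\<lambda>t. (a - b) * sin t * cos t) has_real_derivative (a - b) * (c * c - s * s)) (at t)"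
    by (auto intro!: derivative_eq_intros simp: s_def c_def algebra_simps)
  have d': "((\<lambda>t. b * (cos t)\<^sup>2 + a * (sin t)\<^sup>2) has_real_derivative 2 * (a - b) * s * c) (at t)"
    by (auto intro!: derivative_eq_intros simp: s_def c_def algebra_simps)
  have "((\<lambda>t. t + arctan ((a - b) * sin t * cos t / (b * (cos t)\<^sup>2 + a * (sin t)\<^sup>2)))
      has_real_derivative 1 + inverse (1 + (?n / ?d)\<^sup>2) *
      ((((a - b) * (c * c - s * s)) * ?d - ?n * (2 * (a - b) * s * c)) / (?d * ?d))) (at t)"
    using DERIV_add[OF DERIV_ident DERIV_chain2[OF DERIV_arctan DERIV_divide[OF n' d']]] d
    unfolding s_def c_def by simp
  then show ?thesis unfolding eq by (simp add: s_def c_def)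
qed

text \<open>
  In terms of the polar angle \<open>\<phi>\<close> of the normal \<open>(b cos t, a sin t)\<close>, the integrand is
  \<open>(p cos\<^sup>2 \<phi> + q cos \<phi> sin \<phi> + r sin\<^sup>2 \<phi>) d\<phi>\<close>, and \<open>\<phi>\<close> makes one full turn.
\<close>

lemma has_integral_quadratic_form:
  fixes a b :: real
  assumes ab: "a > 0" "b > 0"
  shows "((\<lambda>t. (p * (b * cos t)\<^sup>2 + q * (b * cos t) * (a * sin t) + r * (a * sin t)\<^sup>2)
      * (a * b) / ((b * cos t)\<^sup>2 + (a * sin t)\<^sup>2)\<^sup>2) has_integral pi * (p + r)) {0..2 * pi}"
proof -
  define X Y D \<phi> where "X t = b * cos t" and "Y t = a * sin t" and "D t = (X t)\<^sup>2 + (Y t)\<^sup>2"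
    and "\<phi> t = t + arctan ((a - b) * sin t * cos t / (b * (cos t)\<^sup>2 + a * (sin t)\<^sup>2))" for t
  \<comment> \<open>the elementary antiderivative in \<open>\<phi>\<close>, with \<open>cos \<phi> = X / sqrt D\<close> and \<open>sin \<phi> = Y / sqrt D\<close>\<close>
  define G where "G t = (p + r) / 2 * \<phi> t + ((p - r) / 2 * (X t * Y t) - q / 2 * (X t)\<^sup>2) / D t" for t
  have D0: "D t \<noteq> 0" for t unfolding D_def X_def Y_def
    by (rule less_imp_neq[OF ellipse_speed_pos[OF ab], symmetric])
  have \<phi>': "(\<phi> has_real_derivative a * b / D t) (at t)" for t
    unfolding \<phi>_def D_def X_def Y_def by (rule ellipse_normal_angle_derivative[OF ab])
  have X: "(X has_real_derivative - (b * sin t)) (at t)"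
    and Y: "(Y has_real_derivative a * cos t) (at t)" for t
    unfolding X_def Y_def by (auto intro!: derivative_eq_intros)
  have "(G has_real_derivative
      (p * (X t)\<^sup>2 + q * X t * Y t + r * (Y t)\<^sup>2) * (a * b) / (D t)\<^sup>2) (at t)" for t
  proof -
    let ?N = "(p - r) / 2 * (X t * Y t) - q / 2 * (X t)\<^sup>2"
    let ?N' = "(p - r) / 2 * (X t * (a * cos t) - b * sin t * Y t) + q * X t * (b * sin t)"
    let ?D' = "2 * Y t * (a * cos t) - 2 * X t * (b * sin t)"
    have N: "((\<lambda>t. (p - r) / 2 * (X t * Y t) - q / 2 * (X t)\<^sup>2) has_real_derivative ?N') (at t)"
      by (auto intro!: derivative_eq_intros X Y simp: field_simps)
    have D: "(D has_real_derivative ?D') (at t)"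
      unfolding D_def[abs_def] by (auto intro!: derivative_eq_intros X Y simp: algebra_simps)
    have G: "(G has_real_derivative
        (p + r) / 2 * (a * b / D t) + (?N' * D t - ?N * ?D') / (D t * D t)) (at t)"
      unfolding G_def[abs_def] by (intro DERIV_add DERIV_cmult \<phi>' DERIV_divide N D D0)
    have sc: "(sin t)\<^sup>2 + (cos t)\<^sup>2 = 1" by simp
    have "(p + r) * (a * b) * D t + 2 * (?N' * D t - ?N * ?D')
        = 2 * ((p * (X t)\<^sup>2 + q * X t * Y t + r * (Y t)\<^sup>2) * (a * b))"
      using sc unfolding D_def X_def Y_def by algebra
    then have "(p + r) / 2 * (a * b / D t) + (?N' * D t - ?N * ?D') / (D t * D t)
        = (p * (X t)\<^sup>2 + q * X t * Y t + r * (Y t)\<^sup>2) * (a * b) / (D t)\<^sup>2"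
      using D0[of t] by (simp add: divide_simps power2_eq_square)
    with G show ?thesis by simp
  qed
  then have "((\<lambda>t. (p * (X t)\<^sup>2 + q * X t * Y t + r * (Y t)\<^sup>2) * (a * b) / (D t)\<^sup>2)
      has_integral G (2 * pi) - G 0) {0..2 * pi}"
    by (intro fundamental_theorem_of_calculus)
      (auto simp flip: has_real_derivative_iff_has_vector_derivative intro: DERIV_subset)
  moreover have "G (2 * pi) - G 0 = pi * (p + r)"
    by (simp add: G_def X_def Y_def D_def \<phi>_def)
  ultimately show ?thesis
    by (simp add: X_def Y_def D_def)
qed

theorem proposition3:
  fixes a b x\<^sub>0 y\<^sub>0 \<theta> :: real
  assumes "a > 0" and "b > 0"
  shows "signed_area (rotated_pedal (ellipse a b) (x\<^sub>0, y\<^sub>0) \<theta>) 0 (2 * pi) =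
           pi / 2 * (a\<^sup>2 + b\<^sup>2 - 2 * a * b * (sin \<theta>)\<^sup>2 + x\<^sub>0\<^sup>2 + y\<^sub>0\<^sup>2)"
proof -
  define C S where "C = cos \<theta>" and "S = sin \<theta>"
  have CS: "S\<^sup>2 + C\<^sup>2 = 1" by (simp add: C_def S_def)
  define X Y D where "X t = b * cos t" and "Y t = a * sin t" and "D t = (X t)\<^sup>2 + (Y t)\<^sup>2" for t
  define u v where "u t = C * X t - S * Y t" and "v t = S * X t + C * Y t" for t
  define u' v' where "u' t = - (C * (b * sin t)) - S * (a * cos t)"
    and "v' t = C * (a * cos t) - S * (b * sin t)" for t
  \<comment> \<open>\<open>A = P \<bullet> w\<close> and \<open>B = M \<bullet> w\<close>, where \<open>w = (u, v)\<close> is the rotated normal\<close>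
  define A B where "A t = a * b * C + S * (b\<^sup>2 - a\<^sup>2) * sin t * cos t"
    and "B t = x\<^sub>0 * u t + y\<^sub>0 * v t" for t
  have D0: "D t \<noteq> 0" for t
    unfolding D_def X_def Y_def
    by (rule less_imp_neq[OF ellipse_speed_pos[OF assms], symmetric])
  have uv: "(u t)\<^sup>2 + (v t)\<^sup>2 = D t" for t
    using CS unfolding D_def u_def v_def by algebra
  have pedal: "rotated_pedal (ellipse a b) (x\<^sub>0, y\<^sub>0) \<theta> t =
      (x\<^sub>0 + (A t - B t) / D t * u t, y\<^sub>0 + (A t - B t) / D t * v t)" for t
  proof -
    have sc: "(sin t)\<^sup>2 + (cos t)\<^sup>2 = 1" by simp
    have "rotate_by \<theta> (vector_derivative (ellipse a b) (at t)) = (- v t, u t)"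
      by (simp add: vector_derivative_ellipse rotate_by_def u_def v_def X_def Y_def C_def S_def)
    moreover have "(a * cos t - x\<^sub>0) * u t + (b * sin t - y\<^sub>0) * v t = A t - B t"
      using sc unfolding A_def B_def u_def v_def X_def Y_def by algebra
    ultimately show ?thesis
      using foot_of_perpendicular_normal[of "u t" "v t" x\<^sub>0 y\<^sub>0 "a * cos t" "b * sin t"] uv[of t] D0[of t]
      by (simp add: rotated_pedal_def ellipse_def)
  qed
  have u: "(u has_real_derivative u' t) (at t)" and v: "(v has_real_derivative v' t) (at t)" for t
    unfolding u_def v_def u'_def v'_def X_def Y_def by (auto intro!: derivative_eq_intros)
  have uv': "u t * v' t - v t * u' t = a * b" for t
  proof -
    have sc: "(sin t)\<^sup>2 + (cos t)\<^sup>2 = 1" by simp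
    then show ?thesis using CS unfolding u_def v_def u'_def v'_def X_def Y_def by algebra
  qed
  have "\<exists>f'. ((\<lambda>t. (A t - B t) / D t) has_real_derivative f') (at t)" for t
    using D0[of t] unfolding A_def B_def u_def v_def X_def Y_def D_def
    by (intro exI) (rule derivative_eq_intros refl | assumption)+
  then obtain f' where f: "\<And>t. ((\<lambda>t. (A t - B t) / D t) has_real_derivative f' t) (at t)"
    by metis
  \<comment> \<open>To write \<open>A\<^sup>2\<close> as a quadratic form in \<open>(X, Y)\<close> up to a multiple of \<open>D\<^sup>2\<close>, use
    \<open>a\<^sup>2 b\<^sup>2 = a\<^sup>2 X\<^sup>2 + b\<^sup>2 Y\<^sup>2\<close> and
    \<open>(b\<^sup>2 - a\<^sup>2)\<^sup>2 sin\<^sup>2 t cos\<^sup>2 t = (a\<^sup>2 + b\<^sup>2) D - D\<^sup>2 - a\<^sup>2 b\<^sup>2\<close>.\<close>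
  define p q r where "p = (C\<^sup>2 - S\<^sup>2) * a\<^sup>2 + S\<^sup>2 * (a\<^sup>2 + b\<^sup>2) + (x\<^sub>0 * C + y\<^sub>0 * S)\<^sup>2"
    and "q = 2 * C * S * (b\<^sup>2 - a\<^sup>2) + 2 * (x\<^sub>0 * C + y\<^sub>0 * S) * (y\<^sub>0 * C - x\<^sub>0 * S)"
    and "r = (C\<^sup>2 - S\<^sup>2) * b\<^sup>2 + S\<^sup>2 * (a\<^sup>2 + b\<^sup>2) + (y\<^sub>0 * C - x\<^sub>0 * S)\<^sup>2"
  have even: "((\<lambda>t. (p * (X t)\<^sup>2 + q * X t * Y t + r * (Y t)\<^sup>2) * (a * b) / (D t)\<^sup>2)
      has_integral pi * (p + r)) {0..2 * pi}"
    unfolding X_def Y_def D_def by (rule has_integral_quadratic_form[OF assms])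
  have odd: "((\<lambda>t. 2 * A t * B t * (a * b) / (D t)\<^sup>2) has_integral 0) {0..2 * pi}"
  proof (rule has_integral_antiperiodic)
    show "continuous_on UNIV (\<lambda>t. 2 * A t * B t * (a * b) / (D t)\<^sup>2)"
      using D0 unfolding A_def B_def D_def u_def v_def X_def Y_def
      by (intro continuous_intros) auto
    fix t
    have "A (t + pi) = A t" "B (t + pi) = - B t" "D (t + pi) = D t"
      by (simp_all add: A_def B_def D_def u_def v_def X_def Y_def algebra_simps)
    then show "2 * A (t + pi) * B (t + pi) * (a * b) / (D (t + pi))\<^sup>2
        = - (2 * A t * B t * (a * b) / (D t)\<^sup>2)" by simp
  qed simp
  have const: "((\<lambda>t. S\<^sup>2 * a * b) has_integral 2 * pi * (S\<^sup>2 * a * b)) {0..2 * pi}"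
    using has_integral_const_real[of "S\<^sup>2 * a * b" 0 "2 * pi"] by simp
  have "((\<lambda>t. ((A t - B t) / D t)\<^sup>2 * (u t * v' t - v t * u' t))
      has_integral pi * (p + r) - 2 * pi * (S\<^sup>2 * a * b) - 0) {0..2 * pi}"
  proof (rule has_integral_eq[OF _ has_integral_diff[OF has_integral_diff[OF even const] odd]])
    fix t :: real
    have sc: "(sin t)\<^sup>2 + (cos t)\<^sup>2 = 1" by simp
    have "(A t)\<^sup>2 + (B t)\<^sup>2 = p * (X t)\<^sup>2 + q * X t * Y t + r * (Y t)\<^sup>2 - S\<^sup>2 * (D t)\<^sup>2"
      using sc CS unfolding A_def B_def D_def u_def v_def X_def Y_def p_def q_def r_def by algebra
    then have sq: "(A t - B t)\<^sup>2 = p * (X t)\<^sup>2 + q * X t * Y t + r * (Y t)\<^sup>2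
        - S\<^sup>2 * (D t)\<^sup>2 - 2 * A t * B t"
      by (simp add: power2_diff)
    show "(p * (X t)\<^sup>2 + q * X t * Y t + r * (Y t)\<^sup>2) * (a * b) / (D t)\<^sup>2 - S\<^sup>2 * a * b
        - 2 * A t * B t * (a * b) / (D t)\<^sup>2 = ((A t - B t) / D t)\<^sup>2 * (u t * v' t - v t * u' t)"
      unfolding uv' power_divide sq using D0[of t] by (simp add: field_simps)
  qed
  from signed_area_translated[OF _ pedal rotated_pedal_ellipse_closed f u v this]
  have "signed_area (rotated_pedal (ellipse a b) (x\<^sub>0, y\<^sub>0) \<theta>) 0 (2 * pi) =
      (pi * (p + r) - 2 * pi * (S\<^sup>2 * a * b)) / 2"
    by simp
  moreover have "p + r = a\<^sup>2 + b\<^sup>2 + x\<^sub>0\<^sup>2 + y\<^sub>0\<^sup>2"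
    using CS unfolding p_def r_def by algebra
  ultimately show ?thesis
    by (simp add: S_def algebra_simps add_divide_distrib diff_divide_distrib)
qed

end
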